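(* Let $A\in\mathbb{R}_+^{\infty\times\infty}$ with $r_{ess}(A)<r(A)$. Then there exists $i_0\in\mathbb{N}$ with $r_{e_{i_0}}(A)=\mu(A)=r(A)$. In particular, $m(A)=r(A)=\mu(A)$.
   Context: $\mathbb{R}_+^{\infty\times\infty}$ is the set of infinite matrices $A=(a_{ij})_{i,j\in\mathbb{N}}$ with non-negative real entries and $\|A\|:=\sup\{a_{ij}:i,j\in\mathbb{N}\}<\infty$, where $\mathbb{N}=\{1,2,\dots\}$. $\ell^\infty_+$ is the set of bounded non-negative sequences with the sup norm, and $e_j$ is the $j$-th standard basis vector. In max algebra, $(A\otimes B)_{ij}=\sup_{k}a_{ik}b_{kj}$, $(A\otimes x)_i=\sup_j a_{ij}x_j$, and $A^k_\otimes$ is the $k$-th power of $A$ for $\otimes$. The max-algebra spectral radius is $r(A)=\lim_{k\to\infty}\|A^k_\otimes\|^{1/k}=\inf_k\|A^k_\otimes\|^{1/k}$ (the limit exists). The local spectral radius at $x\in\ell^\infty_+$ is $r_x(A)=\limsup_{k\to\infty}\|A^k_\otimes\otimes x\|^{1/k}$, and $m(A)=\sup_{j\in\mathbb{N}}r_{e_j}(A)$. For $n\in\mathbb{N}$, $P_n(x_1,x_2,\dots)=(0,\dots,0,x_{n+1},x_{n+2},\dots)$ (first $n$ coordinates replaced by $0$), so $P_nAP_n$ is $A$ with all entries having row or column index $\le n$ replaced by $0$; $r_{ess}(A)=\lim_{n\to\infty}r(P_nAP_n)=\inf_{n}r(P_nAP_n)$. For $i_0,\dots,i_k\in\mathbb{N}$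 put $A(i_k,\dots,i_0)=\prod_{t=0}^{k-1}a_{i_{t+1}i_t}$, and define $\mu(A)=\sup\{A(i_1,i_k,\dots,i_2,i_1)^{1/k}:k\in\mathbb{N},\ i_1,\dots,i_k\in\mathbb{N}\}$. *)

theory Defs
  imports "HOL-Analysis.Analysis"
begin

text \<open>
  Rows, columns and coordinates are numbered from 0, so index \<open>i\<close> here is index \<open>i + 1\<close> in the
  convention where the natural numbers start at 1. All suprema below are suprema of
  reals; they are taken of non-empty bounded sets as long as the matrix is in
  \<open>nonneg_bdd_matrices\<close> and the vector is non-negative and bounded.
\<close>

type_synonym inf_matrix = "nat \<Rightarrow> nat \<Rightarrow> real"
type_synonym inf_vector = "nat \<Rightarrow> real"

definition nonneg_bdd_matrices :: "inf_matrix set" where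
  "nonneg_bdd_matrices =
     {A. (\<forall>i j. 0 \<le> A i j) \<and> bdd_above (range (\<lambda>(i, j). A i j))}"

definition mat_norm :: "inf_matrix \<Rightarrow> real" where
  "mat_norm A = (SUP (i, j). A i j)"

definition vec_norm :: "inf_vector \<Rightarrow> real" where
  "vec_norm x = (SUP i. \<bar>x i\<bar>)"

definition std_basis :: "nat \<Rightarrow> inf_vector" where
  "std_basis j = (\<lambda>i. if i = j then 1 else 0)"

definition max_mult :: "inf_matrix \<Rightarrow> inf_matrix \<Rightarrow> inf_matrix" where
  "max_mult A B = (\<lambda>i j. SUP k. A i k * B k j)"

definition max_apply :: "inf_matrix \<Rightarrow> inf_vector \<Rightarrow> inf_vector" where
  "max_apply A x = (\<lambda>i. SUP j. A i j * x j)"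

primrec max_power :: "inf_matrix \<Rightarrow> nat \<Rightarrow> inf_matrix" where
  "max_power A 0 = (\<lambda>i j. if i = j then 1 else 0)"
| "max_power A (Suc k) = max_mult A (max_power A k)"

definition spec_rad :: "inf_matrix \<Rightarrow> real" where
  "spec_rad A = lim (\<lambda>k. root k (mat_norm (max_power A k)))"

text \<open>
  The library's \<open>limsup\<close> needs a complete lattice, hence the detour through \<open>ereal\<close>. For
  \<open>k \<ge> 1\<close> the sequence lies between 0 and \<open>mat_norm A * root k (vec_norm x)\<close>, so
  its limsup is finite and \<open>real_of_ereal\<close> loses nothing.
\<close>

definition local_spec_rad :: "inf_matrix \<Rightarrow> inf_vector \<Rightarrow> real" where
  "local_spec_rad A x =
     real_of_ereal (limsup (\<lambda>k. ereal (root k (vec_norm (max_apply (max_power A k) x)))))"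

definition sup_local_spec_rad :: "inf_matrix \<Rightarrow> real" where
  "sup_local_spec_rad A = (SUP j. local_spec_rad A (std_basis j))"

text \<open>The matrix \<open>P\<^sub>n A P\<^sub>n\<close>: the first \<open>n\<close> rows and columns are replaced by 0.\<close>

definition tail_matrix :: "nat \<Rightarrow> inf_matrix \<Rightarrow> inf_matrix" where
  "tail_matrix n A = (\<lambda>i j. if n \<le> i \<and> n \<le> j then A i j else 0)"

definition ess_spec_rad :: "inf_matrix \<Rightarrow> real" where
  "ess_spec_rad A = lim (\<lambda>n. spec_rad (tail_matrix n A))"

text \<open>
  \<open>path_weight A k i\<close> is the weight \<open>A(i\<^sub>k, \<dots>, i\<^sub>0)\<close>; only \<open>i 0, \<dots>, i k\<close> matter. A closed
  path of length \<open>k\<close> is encoded by \<open>i k = i 0\<close>.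
\<close>

definition path_weight :: "inf_matrix \<Rightarrow> nat \<Rightarrow> (nat \<Rightarrow> nat) \<Rightarrow> real" where
  "path_weight A k i = (\<Prod>t<k. A (i (Suc t)) (i t))"

definition max_cycle_mean :: "inf_matrix \<Rightarrow> real" where
  "max_cycle_mean A = Sup {root k (path_weight A k i) | k i. k \<ge> 1 \<and> i k = i 0}"

end

theory Submission
  imports Defs
begin

text \<open>
  The entries of the powers are suprema of path weights. Choose \<open>n\<close> such that the tail matrix
  \<open>P\<^sub>n A P\<^sub>n\<close> has spectral radius less than \<open>s\<close>, so that its paths of length \<open>k\<close> weigh at most
  \<open>C s\<^sup>k\<close>. The \<open>n\<close> missing vertices are put back one at a time: splitting a path at its first and
  its last visit to the new vertex \<open>v\<close> shows that the bound survives, with a larger \<open>C\<close>, as long as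
  closed paths through \<open>v\<close> weigh at most \<open>s\<^sup>k\<close>. Hence the spectral radius is at most \<open>s\<close> if the
  finitely many vertices below \<open>n\<close> only carry closed paths of mean at most \<open>s\<close>. It follows that it is
  at most the maximum cycle mean, and that one of these \<open>n\<close> vertices attains it.
\<close>

section \<open>Submultiplicative sequences\<close>

text \<open>Division with remainder: \<open>N k\<close> is at most \<open>N m\<close> times
  \<open>N (k - m)\<close>, and each block of length \<open>m\<close> costs at most
  \<open>c ^ m\<close>. The final remainder \<open>r < m\<close> is absorbed by the
  constant.\<close>

lemma submult_geometric_bound:
  fixes N :: "nat \<Rightarrow> real"
  assumes nonneg: "\<And>k. 0 \<le> N k" and submult: "\<And>a b. N (a + b) \<le> N a * N b"
    and m: "0 < m" and less: "root m (N m) < c"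
  shows "\<exists>C\<ge>1. \<forall>k. N k \<le> C * c ^ k"
proof -
  have c: "0 < c" using less nonneg[of m] real_root_ge_zero[of "N m" m] by linarith
  have Nm: "N m \<le> c ^ m"
    by (metis less less_imp_le m nonneg power_mono real_root_ge_zero real_root_pow_pos2)
  \<comment> \<open>The sum dominates every \<open>N r / c ^ r\<close> with \<open>r < m\<close>;
    the summand 1 only secures \<open>C \<ge> 1\<close>.\<close>
  define C where "C = 1 + (\<Sum>r<m. N r / c ^ r)"
  have C1: "C \<ge> 1" unfolding C_def using nonneg c by (auto intro!: sum_nonneg)
  have "N k \<le> C * c ^ k" for k
  proof (induction k rule: less_induct)
    case (less k)
    show ?case
    proof (cases "k < m")
      case True
      have "N k / c ^ k \<le> (\<Sum>r<m. N r / c ^ r)"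
        using True nonneg c by (intro member_le_sum) auto
      then have "N k / c ^ k \<le> C" by (simp add: C_def)
      then show ?thesis using c by (simp add: field_simps)
    next
      case False
      have "N k \<le> N m * N (k - m)" using submult[of m "k - m"] False by simp
      also have "\<dots> \<le> c ^ m * (C * c ^ (k - m))"
        using less[of "k - m"] False m Nm nonneg c by (intro mult_mono) auto
      also have "\<dots> = C * c ^ k" using False by (simp flip: power_add)
      finally show ?thesis .
    qed
  qed
  with C1 show ?thesis by blast
qed

text \<open>Taking roots turns the constant into \<open>root k C\<close>, which tends to 1, so only
  the rate \<open>c\<close> survives.\<close>

lemma geometric_bound_imp_eventually_root_less:
  fixes N :: "nat \<Rightarrow> real"
  assumes bound: "\<And>k. N k \<le> C * c ^ k" and "0 < C" "0 \<le> c" "c < d"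
  shows "\<forall>\<^sub>F k in sequentially. root k (N k) < d"
proof -
  have "(\<lambda>k. root k C * c) \<longlonglongrightarrow> 1 * c"
    by (intro tendsto_intros LIMSEQ_root_const) fact
  then have "\<forall>\<^sub>F k in sequentially. root k C * c < d"
    using \<open>c < d\<close> by (intro order_tendstoD(2)[of _ "c"]) auto
  then show ?thesis
    using eventually_gt_at_top[of 0]
  proof eventually_elim
    case (elim k)
    have "root k (N k) \<le> root k (C * c ^ k)"
      using elim bound by (intro real_root_le_mono) auto
    also have "\<dots> = root k C * c"
      using elim \<open>0 \<le> c\<close> by (simp add: real_root_mult real_root_power_cancel)
    finally show ?case using elim by simp
  qed
qed

text \<open>Fekete's lemma in multiplicative form: the limit is the infimum \<open>L\<close> over
  positive indices. A single root below \<open>b\<close> yields a geometric bound of rate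
  \<open>b\<close> for the whole sequence.\<close>

lemma submult_root_convergent:
  fixes N :: "nat \<Rightarrow> real"
  assumes nonneg: "\<And>k. 0 \<le> N k" and submult: "\<And>a b. N (a + b) \<le> N a * N b"
  shows "convergent (\<lambda>k. root k (N k))"
proof -
  define L where "L = (INF m\<in>{0<..}. root m (N m))"
  have bdd: "bdd_below ((\<lambda>m. root m (N m)) ` {0<..})"
    using nonneg by (intro bdd_belowI[of _ 0]) auto
  have lower: "L \<le> root m (N m)" if "0 < m" for m
    unfolding L_def using that by (intro cINF_lower bdd) auto
  have "(\<lambda>k. root k (N k)) \<longlonglongrightarrow> L"
  proof (rule order_tendstoI)
    fix a assume "a < L"
    show "\<forall>\<^sub>F k in sequentially. a < root k (N k)"
      using eventually_gt_at_top[of 0]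
      by eventually_elim (rule less_le_trans[OF \<open>a < L\<close> lower])
  next
    fix a assume "L < a"
    then obtain b where b: "L < b" "b < a" using dense by blast
    then obtain m where m: "0 < m" "root m (N m) < b"
      unfolding L_def by (subst (asm) cINF_less_iff) (use bdd in auto)
    then obtain C where C: "C \<ge> 1" "\<And>k. N k \<le> C * b ^ k"
      using submult_geometric_bound[OF nonneg submult] by blast
    have "0 \<le> b" using m real_root_ge_zero[OF nonneg, of m m] by linarith
    then show "\<forall>\<^sub>F k in sequentially. root k (N k) < a"
      using C b by (intro geometric_bound_imp_eventually_root_less[of N C b]) auto
  qed
  then show ?thesis by (rule convergentI)
qed

section \<open>Path weights and powers\<close>

lemma path_weight_add:
  "path_weight A (a + b) p = path_weight A a p * path_weight A b (\<lambda>t. p (t + a))"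
  by (induction b) (simp_all add: path_weight_def ac_simps)

lemma path_weight_Suc: "path_weight A (Suc k) p = path_weight A k p * A (p (Suc k)) (p k)"
  by (simp add: path_weight_def)

lemma path_weight_cong:
  assumes "\<And>t. t \<le> k \<Longrightarrow> p t = q t"
  shows "path_weight A k p = path_weight A k q"
  unfolding path_weight_def using assms by (intro prod.cong) (auto simp: Suc_le_eq)

text \<open>The path runs \<open>q\<close> times around the closed path \<open>p\<close>; closedness
  makes the turns fit together.\<close>

lemma path_weight_periodic:
  assumes "0 < m" "p m = p 0"
  shows "path_weight A (m * q) (\<lambda>t. p (t mod m)) = path_weight A m p ^ q"
proof (induction q)
  case 0
  show ?case by (simp add: path_weight_def)
next
  case (Suc q)
  have "path_weight A m (\<lambda>t. p (t mod m)) = path_weight A m p"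
    using assms by (intro path_weight_cong) (metis le_neq_implies_less mod_less mod_self)
  then show ?case
    using path_weight_add[of A "m * q" m "\<lambda>t. p (t mod m)"] Suc by (simp add: ac_simps)
qed

lemma tail_matrix_0 [simp]: "tail_matrix 0 A = A"
  by (simp add: tail_matrix_def)

context
  fixes A :: inf_matrix
  assumes A: "A \<in> nonneg_bdd_matrices"
begin

lemma entry_nonneg: "0 \<le> A i j"
  using A by (simp add: nonneg_bdd_matrices_def)

lemma entry_le_mat_norm: "A i j \<le> mat_norm A"
  using A cSUP_upper[of "(i, j)" UNIV "\<lambda>(i, j). A i j"]
  by (simp add: nonneg_bdd_matrices_def mat_norm_def)

lemma mat_norm_nonneg: "0 \<le> mat_norm A"
  using entry_nonneg entry_le_mat_norm order_trans by blast

lemma tail_matrix_nonneg_bdd: "tail_matrix n A \<in> nonneg_bdd_matrices"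
  unfolding nonneg_bdd_matrices_def tail_matrix_def
  using entry_nonneg entry_le_mat_norm mat_norm_nonneg
  by (auto intro!: bdd_aboveI[of _ "mat_norm A"])

lemma path_weight_nonneg: "0 \<le> path_weight A k p"
  unfolding path_weight_def by (simp add: prod_nonneg entry_nonneg)

text \<open>Provides the boundedness that every later supremum of reals over power entries relies
  on.\<close>

lemma max_power_bounds: "0 \<le> max_power A k i j \<and> max_power A k i j \<le> mat_norm A ^ k"
proof (induction k arbitrary: i j)
  case 0
  then show ?case by simp
next
  case (Suc k)
  have le: "A i l * max_power A k l j \<le> mat_norm A ^ Suc k" for l
    using Suc entry_nonneg entry_le_mat_norm mat_norm_nonneg by (auto intro!: mult_mono)
  have "0 \<le> (SUP l. A i l * max_power A k l j)"
    using Suc entry_nonneg le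
    by (intro cSUP_upper2[of _ _ 0] bdd_aboveI[of _ "mat_norm A ^ Suc k"]) auto
  moreover have "(SUP l. A i l * max_power A k l j) \<le> mat_norm A ^ Suc k"
    using le by (intro cSUP_least) auto
  ultimately show ?case by (simp add: max_mult_def)
qed

lemma path_weight_le_max_power: "path_weight A k p \<le> max_power A k (p k) (p 0)"
proof (induction k)
  case 0
  then show ?case by (simp add: path_weight_def)
next
  case (Suc k)
  have "path_weight A (Suc k) p \<le> A (p (Suc k)) (p k) * max_power A k (p k) (p 0)"
    using mult_right_mono[OF Suc entry_nonneg, of "p (Suc k)" "p k"] by (simp add: path_weight_Suc mult.commute)
  also have "\<dots> \<le> (SUP l. A (p (Suc k)) l * max_power A k l (p 0))"
    using max_power_bounds entry_nonneg entry_le_mat_norm mat_norm_nonneg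
    by (intro cSUP_upper bdd_aboveI[of _ "mat_norm A * mat_norm A ^ k"])
      (auto intro!: mult_mono)
  finally show ?case by (simp add: max_mult_def)
qed

text \<open>With \<open>path_weight_le_max_power\<close>, this makes each entry of a power the
  supremum of the weights of the paths from \<open>j\<close> to \<open>i\<close>. The induction
  varies \<open>B\<close>, because the last edge weight is divided out. The condition
  \<open>0 \<le> B\<close> covers \<open>k = 0\<close>, \<open>i \<noteq> j\<close>, where no path
  exists and the entry is 0.\<close>

lemma max_power_leI:
  assumes "\<And>p. p k = i \<Longrightarrow> p 0 = j \<Longrightarrow> path_weight A k p \<le> B" "0 \<le> B"
  shows "max_power A k i j \<le> B"
  using assms
proof (induction k arbitrary: i B)
  case 0
  then show ?case using "0.prems"(1)[of "\<lambda>_. i"] by (auto simp: path_weight_def)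
next
  case (Suc k)
  have "A i l * max_power A k l j \<le> B" for l
  proof (cases "A i l = 0")
    case True
    then show ?thesis using Suc.prems by simp
  next
    case False
    then have pos: "0 < A i l" using entry_nonneg[of i l] by simp
    have "max_power A k l j \<le> B / A i l"
    proof (rule Suc.IH)
      fix p assume p: "p k = l" "p 0 = j"
      \<comment> \<open>The path \<open>p\<close> is prolonged by the edge from \<open>l\<close> to
        \<open>i\<close>.\<close>
      have "path_weight A k (\<lambda>t. if t = Suc k then i else p t) = path_weight A k p"
        by (intro path_weight_cong) auto
      then have "path_weight A k p * A i l \<le> B"
        using Suc.prems(1)[of "\<lambda>t. if t = Suc k then i else p t"] p
        by (simp add: path_weight_Suc)
      then show "path_weight A k p \<le> B / A i l" using pos by (simp add: field_simps)
    qed (use pos Suc.prems in simp)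
    then show ?thesis using pos by (simp add: field_simps)
  qed
  then show ?case by (auto simp: max_mult_def intro!: cSUP_least)
qed

lemma max_power_le_mat_norm: "max_power A k i j \<le> mat_norm (max_power A k)"
proof -
  have "bdd_above (range (\<lambda>(i, j). max_power A k i j))"
    using max_power_bounds by (intro bdd_aboveI[of _ "mat_norm A ^ k"]) auto
  from cSUP_upper[OF UNIV_I[of "(i, j)"] this] show ?thesis by (simp add: mat_norm_def)
qed

lemma path_weight_le_mat_norm: "path_weight A k p \<le> mat_norm (max_power A k)"
  using path_weight_le_max_power max_power_le_mat_norm order_trans by blast

lemma mat_norm_max_power_nonneg: "0 \<le> mat_norm (max_power A k)"
  using path_weight_nonneg path_weight_le_mat_norm order_trans by blast

lemma mat_norm_max_power_leI:
  assumes "\<And>p. path_weight A k p \<le> B"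
  shows "mat_norm (max_power A k) \<le> B"
proof -
  have "0 \<le> B" using assms path_weight_nonneg order_trans by blast
  then show ?thesis
    unfolding mat_norm_def using max_power_leI[of k _ _ B] assms
    by (intro cSUP_least) auto
qed

text \<open>A path of length \<open>a + b\<close> is cut after \<open>a\<close> steps and both
  pieces are bounded separately.\<close>

lemma mat_norm_max_power_add:
  "mat_norm (max_power A (a + b)) \<le> mat_norm (max_power A a) * mat_norm (max_power A b)"
  by (intro mat_norm_max_power_leI)
    (auto simp: path_weight_add intro!: mult_mono path_weight_le_mat_norm path_weight_nonneg
      mat_norm_max_power_nonneg)

section \<open>Spectral radii\<close>

lemma spec_rad_tendsto: "(\<lambda>k. root k (mat_norm (max_power A k))) \<longlonglongrightarrow> spec_rad A"
  unfolding spec_rad_def using mat_norm_max_power_nonneg mat_norm_max_power_add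
  by (intro convergent_LIMSEQ_iff[THEN iffD1] submult_root_convergent)

lemma spec_rad_nonneg: "0 \<le> spec_rad A"
  using mat_norm_max_power_nonneg
  by (intro LIMSEQ_le_const[OF spec_rad_tendsto] exI[of _ 0])
    (simp add: real_root_ge_zero)

text \<open>Together with its converse below, this replaces the spectral radius by uniform geometric
  bounds on path weights, which can be handled combinatorially.\<close>

lemma spec_rad_less_imp_geometric_bound:
  assumes "spec_rad A < c"
  shows "\<exists>C\<ge>1. \<forall>k p. path_weight A k p \<le> C * c ^ k"
proof -
  have "\<forall>\<^sub>F k in sequentially. root k (mat_norm (max_power A k)) < c \<and> 0 < k"
    using order_tendstoD(2)[OF spec_rad_tendsto assms] eventually_gt_at_top[of 0]
    by eventually_elim simp
  then obtain m where "root m (mat_norm (max_power A m)) < c" "0 < m"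
    using eventually_happens' sequentially_bot by blast
  then obtain C where "C \<ge> 1" "\<And>k. mat_norm (max_power A k) \<le> C * c ^ k"
    using submult_geometric_bound[OF mat_norm_max_power_nonneg mat_norm_max_power_add] by blast
  then show ?thesis using path_weight_le_mat_norm order_trans by blast
qed

lemma geometric_bound_imp_spec_rad_le:
  assumes "\<And>k p. path_weight A k p \<le> C * c ^ k" "0 < C" "0 \<le> c"
  shows "spec_rad A \<le> c"
proof (rule ccontr)
  assume "\<not> spec_rad A \<le> c"
  then obtain d where d: "c < d" "d < spec_rad A" using dense[of c] by force
  have "\<forall>\<^sub>F k in sequentially. root k (mat_norm (max_power A k)) < d"
    using mat_norm_max_power_leI assms d
    by (intro geometric_bound_imp_eventually_root_less[of _ C c]) auto
  then have "spec_rad A \<le> d"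
    by (intro tendsto_upperbound[OF spec_rad_tendsto]) (auto elim: eventually_mono)
  with d show False by simp
qed

section \<open>Local spectral radii at basis vectors and cycle means\<close>

lemma max_apply_std_basis: "max_apply (max_power A k) (std_basis j) i = max_power A k i j"
  unfolding max_apply_def
proof (rule antisym)
  show "(SUP l. max_power A k i l * std_basis j l) \<le> max_power A k i j"
    using max_power_bounds by (intro cSUP_least) (auto simp: std_basis_def)
  have "bdd_above (range (\<lambda>l. max_power A k i l * std_basis j l))"
    using max_power_bounds
    by (intro bdd_aboveI[of _ "max_power A k i j"]) (auto simp: std_basis_def)
  from cSUP_upper[OF UNIV_I[of j] this]
  show "max_power A k i j \<le> (SUP l. max_power A k i l * std_basis j l)"
    by (simp add: std_basis_def)
qed

lemma vec_norm_orbit_le: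
  "vec_norm (max_apply (max_power A k) (std_basis j)) \<le> mat_norm (max_power A k)"
  unfolding vec_norm_def using max_power_bounds max_power_le_mat_norm
  by (intro cSUP_least) (auto simp: max_apply_std_basis)

lemma path_weight_le_vec_norm_orbit:
  "path_weight A k p \<le> vec_norm (max_apply (max_power A k) (std_basis (p 0)))"
proof -
  have "bdd_above (range (\<lambda>i. \<bar>max_apply (max_power A k) (std_basis (p 0)) i\<bar>))"
    using max_power_bounds
    by (intro bdd_aboveI[of _ "mat_norm A ^ k"]) (auto simp: max_apply_std_basis)
  from cSUP_upper[OF UNIV_I[of "p k"] this] show ?thesis
    using path_weight_le_max_power[of k p] max_power_bounds[of k "p k" "p 0"]
    by (simp add: vec_norm_def max_apply_std_basis)
qed

lemma vec_norm_orbit_nonneg: "0 \<le> vec_norm (max_apply (max_power A k) (std_basis j))"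
  using path_weight_le_vec_norm_orbit[of k "\<lambda>_. j"] path_weight_nonneg order_trans by blast

text \<open>Both bounds together make the limsup finite, so \<open>real_of_ereal\<close> does not
  fall back on its default value.\<close>

lemma limsup_orbit_bounds:
  defines "u j \<equiv> \<lambda>k. ereal (root k (vec_norm (max_apply (max_power A k) (std_basis j))))"
  shows "0 \<le> limsup (u j)" and "limsup (u j) \<le> ereal (spec_rad A)"
proof -
  have "0 \<le> liminf (u j)"
    using vec_norm_orbit_nonneg by (intro Liminf_bounded) (simp add: u_def real_root_ge_zero)
  also have "\<dots> \<le> limsup (u j)" by (intro Liminf_le_Limsup) simp
  finally show "0 \<le> limsup (u j)" .
  have "root k (vec_norm (max_apply (max_power A k) (std_basis j)))
      \<le> root k (mat_norm (max_power A k))" for k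
    using vec_norm_orbit_le by (cases "k = 0") auto
  then have "limsup (u j) \<le> limsup (\<lambda>k. ereal (root k (mat_norm (max_power A k))))"
    unfolding u_def by (intro Limsup_mono) auto
  also have "\<dots> = ereal (spec_rad A)"
    using spec_rad_tendsto by (intro lim_imp_Limsup) auto
  finally show "limsup (u j) \<le> ereal (spec_rad A)" .
qed

lemma local_spec_rad_le_spec_rad: "local_spec_rad A (std_basis j) \<le> spec_rad A"
  using limsup_orbit_bounds[of j] unfolding local_spec_rad_def
  by (metis real_of_ereal.simps(1) real_of_ereal_positive_mono PInfty_neq_ereal(1))

text \<open>Running \<open>q\<close> times around the cycle shows that the orbit of its base vertex
  has norm at least the \<open>q\<close>-th power of the cycle weight at time \<open>m * q\<close>.
  A limsup along these times is at most the full limsup.\<close>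

lemma cycle_mean_le_local_spec_rad:
  assumes "0 < m" "p m = p 0"
  shows "root m (path_weight A m p) \<le> local_spec_rad A (std_basis (p 0))"
proof -
  define u where
    "u k = ereal (root k (vec_norm (max_apply (max_power A k) (std_basis (p 0)))))" for k
  \<comment> \<open>The case \<open>q = 0\<close> is excluded because \<open>root 0\<close> is
    constantly 0.\<close>
  have "root m (path_weight A m p) \<le> u (m * q)" if "0 < q" for q
  proof -
    have "root m (path_weight A m p) = root (m * q) (path_weight A m p ^ q)"
      using that path_weight_nonneg assms
      by (simp add: real_root_mult_exp real_root_power_cancel mult.commute[of m q])
         (simp add: real_root_power_cancel real_root_power)
    also have "path_weight A m p ^ q
        \<le> vec_norm (max_apply (max_power A (m * q)) (std_basis (p 0)))"
      using path_weight_le_vec_norm_orbit[of "m * q" "\<lambda>t. p (t mod m)"]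
        path_weight_periodic[OF assms, of A q] by simp
    finally show ?thesis using that assms by (simp add: u_def real_root_le_mono)
  qed
  then have "ereal (root m (path_weight A m p)) \<le> liminf (\<lambda>q. u (m * q))"
    by (intro Liminf_bounded eventually_mono[OF eventually_gt_at_top[of 0]])
  also have "\<dots> \<le> limsup (\<lambda>q. u (m * q))" by (intro Liminf_le_Limsup) simp
  also have "\<dots> \<le> limsup u"
    using limsup_subseq_mono[of "\<lambda>q. m * q" u] assms by (simp add: strict_mono_def o_def)
  finally have "ereal (root m (path_weight A m p)) \<le> limsup u" .
  moreover have "limsup u \<le> ereal (spec_rad A)"
    using limsup_orbit_bounds(2)[of "p 0"] unfolding u_def .
  ultimately show ?thesis
    unfolding local_spec_rad_def u_def[symmetric] by (cases "limsup u") auto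
qed

section \<open>Adding one vertex\<close>

text \<open>Between the first and the last visit to \<open>v\<close> a path is one closed path
  through \<open>v\<close>, bounded by \<open>cycles\<close> without any constant. Before and after,
  it avoids \<open>v\<close> up to one connecting edge. Thus only two factors \<open>K\<close>
  arise, however often \<open>v\<close> is visited.\<close>

lemma path_weight_add_vertex:
  assumes A': "\<And>i j. i \<noteq> v \<Longrightarrow> j \<noteq> v \<Longrightarrow> A i j = A' i j"
    and s: "0 < s" and "C \<ge> 1"
    and bound: "\<And>k p. path_weight A' k p \<le> C * s ^ k"
    and cycles: "\<And>k p. p 0 = v \<Longrightarrow> p k = v \<Longrightarrow> path_weight A k p \<le> s ^ k"
  shows "\<exists>C\<ge>1. \<forall>k p. path_weight A k p \<le> C * s ^ k"
proof -
  \<comment> \<open>\<open>K\<close> bounds a segment avoiding \<open>v\<close> also after one edge,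
    of weight at most \<open>mat_norm A\<close>, is attached: the quotient by \<open>s\<close>
    accounts for the extra step.\<close>
  define K where "K = max C (mat_norm A * C / s)"
  have K: "K \<ge> 1" "C \<le> K" "mat_norm A * C / s \<le> K"
    using \<open>C \<ge> 1\<close> by (auto simp: K_def)
  then have Ks: "mat_norm A * C \<le> K * s" using s by (simp add: pos_divide_le_eq)
  have avoid: "path_weight A k p \<le> C * s ^ k" if "\<And>t. t \<le> k \<Longrightarrow> p t \<noteq> v" for k p
  proof -
    have "path_weight A k p = path_weight A' k p"
      unfolding path_weight_def using that A' by (intro prod.cong) auto
    then show ?thesis using bound by simp
  qed
  have edge: "A i j * w \<le> K * s ^ Suc k" if "w \<le> C * s ^ k" for i j w k
  proof -
    have "A i j * w \<le> A i j * (C * s ^ k)" using that entry_nonneg by (intro mult_left_mono) auto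
    also have "\<dots> \<le> mat_norm A * (C * s ^ k)"
      using entry_le_mat_norm \<open>C \<ge> 1\<close> s by (intro mult_right_mono) auto
    also have "\<dots> \<le> K * s * s ^ k"
      using mult_right_mono[OF Ks, of "s ^ k"] s by (simp add: ac_simps)
    finally show ?thesis by (simp add: ac_simps)
  qed
  have into: "path_weight A k p \<le> K * s ^ k" if "p k = v" for k p
  proof -
    \<comment> \<open>First visit to \<open>v\<close>: the part before it avoids \<open>v\<close>
      except at its end, and the rest is a closed path.\<close>
    define a where "a = (LEAST t. p t = v)"
    have pa: "p a = v" and "a \<le> k" using that by (auto simp: a_def intro: LeastI Least_le)
    have before: "p t \<noteq> v" if "t < a" for t using that not_less_Least by (auto simp: a_def)
    have 1: "path_weight A a p \<le> K * s ^ a"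
    proof (cases a)
      case 0
      then show ?thesis using K by (simp add: path_weight_def)
    next
      case (Suc b)
      have "path_weight A b p \<le> C * s ^ b" using before Suc by (intro avoid) auto
      from edge[OF this, of "p (Suc b)" "p b"] show ?thesis using Suc by (simp add: path_weight_Suc mult.commute)
    qed
    have 2: "path_weight A (k - a) (\<lambda>t. p (t + a)) \<le> s ^ (k - a)"
      using pa that \<open>a \<le> k\<close> by (intro cycles) auto
    have "path_weight A k p = path_weight A a p * path_weight A (k - a) (\<lambda>t. p (t + a))"
      using path_weight_add[of A a "k - a" p] \<open>a \<le> k\<close> by simp
    also have "\<dots> \<le> (K * s ^ a) * s ^ (k - a)"
      using 1 2 K s path_weight_nonneg by (intro mult_mono) auto
    also have "\<dots> = K * s ^ k" using \<open>a \<le> k\<close> by (simp flip: power_add)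
    finally show ?thesis .
  qed
  have "path_weight A k p \<le> K * K * s ^ k" for k p
  proof (cases "\<exists>t\<le>k. p t = v")
    case False
    then have "path_weight A k p \<le> C * s ^ k" by (intro avoid) auto
    also have "\<dots> \<le> K * K * s ^ k"
      using K s mult_mono[of 1 K C K] \<open>C \<ge> 1\<close> by (intro mult_right_mono) auto
    finally show ?thesis .
  next
    case True
    \<comment> \<open>Last visit to \<open>v\<close>: the part up to it is covered by
      \<open>into\<close>, and the part after it leaves \<open>v\<close> by one edge and never
      returns.\<close>
    define b where "b = (GREATEST t. t \<le> k \<and> p t = v)"
    have "b \<le> k \<and> p b = v"
      unfolding b_def using True by (rule GreatestI_ex_nat[where b = k]) simp
    then have b: "b \<le> k" "p b = v" by auto
    have after: "p t \<noteq> v" if "b < t" "t \<le> k" for t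
      using that Greatest_le_nat[of "\<lambda>t. t \<le> k \<and> p t = v" t k] by (auto simp: b_def)
    have "path_weight A (k - b) (\<lambda>t. p (t + b)) \<le> K * s ^ (k - b)"
    proof (cases "k - b")
      case 0
      then show ?thesis using K by (simp add: path_weight_def)
    next
      case (Suc d)
      have "path_weight A d (\<lambda>t. p (t + 1 + b)) \<le> C * s ^ d"
        using after Suc by (intro avoid) auto
      from edge[OF this, of "p (1 + b)" "p b"] show ?thesis
        using path_weight_add[of A 1 d "\<lambda>t. p (t + b)"] Suc by (simp add: path_weight_def)
    qed
    then have "path_weight A b p * path_weight A (k - b) (\<lambda>t. p (t + b))
        \<le> (K * s ^ b) * (K * s ^ (k - b))"
      using into[of p b] b K s path_weight_nonneg by (intro mult_mono) auto
    also have "\<dots> = K * K * (s ^ b * s ^ (k - b))" by (simp add: ac_simps)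
    also have "s ^ b * s ^ (k - b) = s ^ k" using b by (simp flip: power_add)
    finally show ?thesis using path_weight_add[of A b "k - b" p] b by simp
  qed
  moreover have "1 \<le> K * K" using K mult_mono[of 1 K 1 K] by simp
  ultimately show ?thesis by blast
qed

end

section \<open>Passing from tail matrices to the full matrix\<close>

lemma path_weight_tail_le:
  assumes "A \<in> nonneg_bdd_matrices" "n' \<le> n"
  shows "path_weight (tail_matrix n A) k p \<le> path_weight (tail_matrix n' A) k p"
  unfolding path_weight_def tail_matrix_def using entry_nonneg[OF assms(1)] assms(2)
  by (intro prod_mono) auto

lemma spec_rad_le_of_tail_and_cycles:
  assumes A: "A \<in> nonneg_bdd_matrices" and tail: "spec_rad (tail_matrix n A) < s"
    and cycles: "\<And>k p. 0 < k \<Longrightarrow> p k = p 0 \<Longrightarrow> p 0 < n \<Longrightarrow> root k (path_weight A k p) \<le> s"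
  shows "spec_rad A \<le> s"
proof -
  have s: "0 < s"
    using spec_rad_nonneg[OF tail_matrix_nonneg_bdd[OF A]] tail by (rule le_less_trans)
  have "\<exists>C\<ge>1. \<forall>k p. path_weight (tail_matrix 0 A) k p \<le> C * s ^ k"
    using le0[of n]
  \<comment> \<open>Downward induction from \<open>n\<close> to 0: passing from
    \<open>tail_matrix (Suc v) A\<close> to \<open>tail_matrix v A\<close> restores exactly the
    vertex \<open>v\<close>.\<close>
  proof (induction rule: inc_induct)
    case base
    show ?case by (rule spec_rad_less_imp_geometric_bound[OF tail_matrix_nonneg_bdd[OF A] tail])
  next
    case (step v)
    then obtain C where C: "C \<ge> 1"
      "\<And>k p. path_weight (tail_matrix (Suc v) A) k p \<le> C * s ^ k" by blast
    show ?case
    proof (rule path_weight_add_vertex[OF tail_matrix_nonneg_bdd[OF A] _ s C])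
      fix i j assume "i \<noteq> v" "j \<noteq> v"
      then show "tail_matrix v A i j = tail_matrix (Suc v) A i j"
        by (auto simp: tail_matrix_def)
    next
      fix k and p :: "nat \<Rightarrow> nat" assume p: "p 0 = v" "p k = v"
      show "path_weight (tail_matrix v A) k p \<le> s ^ k"
      \<comment> \<open>The cycle hypothesis speaks only of positive lengths; the empty path has
        weight 1.\<close>
      proof (cases "k = 0")
        case True
        then show ?thesis by (simp add: path_weight_def)
      next
        case False
        have "path_weight (tail_matrix v A) k p \<le> path_weight A k p"
          using path_weight_tail_le[OF A, of 0 v] by simp
        also have "\<dots> = root k (path_weight A k p) ^ k"
          using False path_weight_nonneg[OF A] by simp
        also have "\<dots> \<le> s ^ k"
          using cycles[of k p] False p step path_weight_nonneg[OF A]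
          by (intro power_mono) auto
        finally show ?thesis .
      qed
    qed
  qed
  then obtain C where "C \<ge> 1" "\<And>k p. path_weight A k p \<le> C * s ^ k" by auto
  then show ?thesis using s by (intro geometric_bound_imp_spec_rad_le[OF A, of C]) auto
qed

text \<open>Entries of the tail matrices decrease with \<open>n\<close>, hence so do their spectral
  radii, which are bounded below by 0. So the \<open>lim\<close> in \<open>ess_spec_rad\<close> is a
  genuine limit.\<close>

lemma ess_spec_rad_less_imp_tail_less:
  assumes A: "A \<in> nonneg_bdd_matrices" and "ess_spec_rad A < c"
  shows "\<exists>n. spec_rad (tail_matrix n A) < c"
proof -
  let ?r = "\<lambda>n. spec_rad (tail_matrix n A)"
  note tail = tail_matrix_nonneg_bdd[OF A]
  have "mat_norm (max_power (tail_matrix n A) k) \<le> mat_norm (max_power (tail_matrix n' A) k)"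
    if "n' \<le> n" for n n' k
    by (rule mat_norm_max_power_leI[OF tail])
      (rule order_trans[OF path_weight_tail_le[OF A that] path_weight_le_mat_norm[OF tail]])
  then have "root k (mat_norm (max_power (tail_matrix n A) k))
      \<le> root k (mat_norm (max_power (tail_matrix n' A) k))" if "n' \<le> n" for n n' k
    using that by (cases "k = 0") auto
  then have "decseq ?r"
    unfolding decseq_def
    by (intro allI impI LIMSEQ_le[OF spec_rad_tendsto spec_rad_tendsto] tail) auto
  then obtain L where L: "?r \<longlonglongrightarrow> L"
    using decseq_convergent[of ?r 0] spec_rad_nonneg[OF tail] by blast
  then have "L < c" using assms(2) by (simp add: ess_spec_rad_def limI)
  then show ?thesis
    using eventually_happens'[OF sequentially_bot order_tendstoD(2)[OF L]] by blast
qed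

theorem theorem3p7:
  fixes A :: inf_matrix
  assumes "A \<in> nonneg_bdd_matrices"
    and "ess_spec_rad A < spec_rad A"
  shows "(\<exists>i0. local_spec_rad A (std_basis i0) = max_cycle_mean A \<and> max_cycle_mean A = spec_rad A)
    \<and> sup_local_spec_rad A = spec_rad A \<and> spec_rad A = max_cycle_mean A"
proof -
  note A = assms(1)
  let ?l = "\<lambda>j. local_spec_rad A (std_basis j)"
  let ?S = "{root k (path_weight A k i) | k i. k \<ge> 1 \<and> i k = i 0}"
  obtain n where n: "spec_rad (tail_matrix n A) < spec_rad A"
    using ess_spec_rad_less_imp_tail_less[OF assms] by blast
  \<comment> \<open>The gap below \<open>spec_rad A\<close> lets \<open>c\<close> serve as a rate
    for the tail without ever being a maximum that reaches \<open>spec_rad A\<close>.\<close>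
  then obtain c where c: "spec_rad (tail_matrix n A) < c" "c < spec_rad A" using dense by blast
  have le: "?l j \<le> spec_rad A" for j by (rule local_spec_rad_le_spec_rad[OF A])
  have cyc: "root k (path_weight A k p) \<le> ?l (p 0)" if "0 < k" "p k = p 0" for k p
    using cycle_mean_le_local_spec_rad[OF A] that by blast
  have S_le: "x \<le> spec_rad A" if x: "x \<in> ?S" for x
  proof -
    obtain k p where "x = root k (path_weight A k p)" "1 \<le> k" "p k = p 0"
      using x by blast
    then show ?thesis using order_trans[OF cyc le, of k p] by simp
  qed
  \<comment> \<open>The loop at vertex 0 shows that \<open>?S\<close> is non-empty.\<close>
  have "root 1 (path_weight A 1 (\<lambda>_. 0)) \<in> ?S" by blast
  then have mu_le: "max_cycle_mean A \<le> spec_rad A"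
    unfolding max_cycle_mean_def using S_le by (intro cSup_least) auto
  have le_mu: "root k (path_weight A k p) \<le> max_cycle_mean A" if "0 < k" "p k = p 0" for k p
    unfolding max_cycle_mean_def using S_le that
    by (intro cSup_upper bdd_aboveI[of _ "spec_rad A"]) (auto simp: Suc_le_eq)
  have "spec_rad A \<le> max c (max_cycle_mean A)"
    using c le_mu
    by (intro spec_rad_le_of_tail_and_cycles[OF A, of n]) (auto simp: le_max_iff_disj)
  then have mu: "max_cycle_mean A = spec_rad A" using mu_le c by auto
  \<comment> \<open>Only the finitely many vertices below \<open>n\<close> enter, so the maximum is
    attained. Including \<open>c\<close> keeps the set non-empty and \<open>s\<close> above the
    spectral radius of the tail.\<close>
  define s where "s = Max (insert c (?l ` {..<n}))"
  have "spec_rad A \<le> s"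
  proof (rule spec_rad_le_of_tail_and_cycles[OF A])
    have "c \<le> s" unfolding s_def by (intro Max_ge) auto
    then show "spec_rad (tail_matrix n A) < s" using c by simp
    fix k and p :: "nat \<Rightarrow> nat" assume p: "0 < k" "p k = p 0" "p 0 < n"
    then have "?l (p 0) \<le> s" unfolding s_def by (intro Max_ge) auto
    with cyc[of k p] p show "root k (path_weight A k p) \<le> s" by simp
  qed
  moreover have "s \<in> insert c (?l ` {..<n})" unfolding s_def by (intro Max_in) auto
  \<comment> \<open>The value \<open>s = c\<close> is ruled out by \<open>c < spec_rad A\<close>, so
    some vertex below \<open>n\<close> attains \<open>s\<close>.\<close>
  ultimately obtain i0 where i0: "spec_rad A \<le> ?l i0" using c by auto
  then have eq: "?l i0 = spec_rad A" using le[of i0] by simp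
  have "sup_local_spec_rad A = spec_rad A"
    unfolding sup_local_spec_rad_def
  proof (rule antisym)
    show "(SUP j. ?l j) \<le> spec_rad A" using le by (intro cSUP_least) auto
    show "spec_rad A \<le> (SUP j. ?l j)"
      using le i0 by (intro cSUP_upper2[of _ _ i0] bdd_aboveI[of _ "spec_rad A"]) auto
  qed
  with mu eq show ?thesis by auto
qed

end
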